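(* Let $k\ge 2$ be an integer and fix $c,\kappa,K>0$. There is a constant $C$, depending only on $k,c,\kappa,K$, such that the following holds. Let $n\ge1$ be an integer and $d$ a real number with $1\le d<n^2$ and $d\ge c\log n$; put $\tau=\sqrt d/n$ and $$L=1+\left\lfloor\log_2(1/\tau)\right\rfloor .$$ Let $T=(t_{\mathbf i})_{\mathbf i\in[n]^k}$ be a (deterministic) tensor with nonnegative entries satisfying both of the following: (i) every one-dimensional fiber of $T$ has degree at most $\kappa d$; (ii) for every choice of a labeled partial partition with labels in $\{0,\dots,L-1\}$ in each mode $j=1,\dots,k$, and every nonempty collection $\mathcal B$ of its box labels, $$\sum_{\mathbf b\in\mathcal B}I_{\mathbf b}\le K\bigl(H(\mathcal B)+|\mathcal B|\log(eL)\bigr),$$ where $I_{\mathbf b}=I_{\mu_{\mathbf b}}(e(Q_{\mathbf b}))$ and $\mu_{\mathbf b}=(d/n)|Q_{\mathbf b}|$. Then $$\sup_{\|x_1\|_2=\cdots=\|x_k\|_2=1}\ \sum_{\mathbf i\in\mathcal H(x)}t_{\mathbf i}\prod_{j=1}^k|x_{j,i_j}|\le C\sqrt d,$$ where the supremum is over unit vectors $x_1,\dots,x_k\in\mathbb R^n$, and for $x=(x_1,\dots,x_k)$, $$\mathcal H(x)=\Big\{\mathbf i\in[n]^k:\ \prod_{j=1}^k|x_{j,i_j}|>\tau\Big\}.$$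
   Context: Write $[n]=\{1,\dots,n\}$, $\mathbf i=(i_1,\dots,i_k)$, and $x_{j,i}$ for the $i$th coordinate of $x_j$; $\log$ is the natural logarithm and, inside logarithms, $e$ is Euler's number. Fibers: a one-dimensional fiber $F\subseteq[n]^k$ is obtained by fixing all indices except one; its degree is $\sum_{\mathbf i\in F}t_{\mathbf i}$. Rate function: for $\mu>0$ and $u\ge 0$, $I_\mu(u)=u\log(u/\mu)-u+\mu$ if $u\ge\mu$, and $I_\mu(u)=0$ if $0\le u<\mu$. Box counts: for $Q=S_1\times\cdots\times S_k$ with $S_j\subseteq[n]$, $e(Q)=\sum_{\mathbf i\in Q}t_{\mathbf i}$. Labeled partial partitions: in mode $j$, a labeled partial partition consists of pairwise disjoint nonempty sets $D_j^\ell\subseteq[n]$, for $\ell$ ranging over some subset of $\{0,\dots,L-1\}$ (the assigned labels in mode $j$). No disjointness is required between different modes. Given one labeled partial partition in each mode, a box label is a tuple $\mathbf b=(\ell_1,\dots,\ell_k)$ with $\ell_j$ an assigned label in mode $j$; write $\mathbf b_j=\ell_j$ and $Q_{\mathbf b}=D_1^{\ell_1}\times\cdots\times D_k^{\ell_k}$. Entropy: for a collection $\mathcal B$ of box labels let $\mathcal B_j=\{\mathbf b_j:\mathbf b\in\mathcal B\}$ and, for nonempty $S\subseteq[n]$, $h(S)=|S|\log\frac{en}{|S|}$. Then $H(\mathcal B)=\sum_{j=1}^k\sum_{\ell\in\mathcal B_j}h(D_j^\ell)$. *)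

theory Defs
  imports "HOL-Analysis.Analysis" "HOL-Library.Disjoint_Sets"
begin

text \<open>
  Multi-indices in \<open>[n]\<^sup>k\<close> are functions in \<open>{1..k} \<rightarrow>\<^sub>E {1..n}\<close>, i.e. they are pinned to
  \<open>undefined\<close> outside the set of modes \<open>{1..k}\<close>, so that cardinalities and sums over sets of
  multi-indices are the intended ones.  A tensor is a real function on multi-indices of which
  only the values on \<open>[n]\<^sup>k\<close> matter, and \<open>x j i\<close> is the \<open>i\<close>th coordinate of the vector \<open>x j\<close>.
\<close>

definition multi_indices :: "nat \<Rightarrow> nat \<Rightarrow> (nat \<Rightarrow> nat) set" where
  "multi_indices k n = {1..k} \<rightarrow>\<^sub>E {1..n}"

definition fiber :: "nat \<Rightarrow> nat \<Rightarrow> nat \<Rightarrow> (nat \<Rightarrow> nat) \<Rightarrow> (nat \<Rightarrow> nat) set" where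
  "fiber k n j a = {i \<in> multi_indices k n. \<forall>m \<in> {1..k} - {j}. i m = a m}"

definition fibers :: "nat \<Rightarrow> nat \<Rightarrow> (nat \<Rightarrow> nat) set set" where
  "fibers k n = {fiber k n j a | j a. j \<in> {1..k} \<and> a \<in> multi_indices k n}"

text \<open>The degree of a fiber and the count \<open>e(Q)\<close> of a box are both sums of tensor entries.\<close>

definition entry_sum :: "((nat \<Rightarrow> nat) \<Rightarrow> real) \<Rightarrow> (nat \<Rightarrow> nat) set \<Rightarrow> real" where
  "entry_sum t F = (\<Sum>i\<in>F. t i)"

definition rate :: "real \<Rightarrow> real \<Rightarrow> real" where
  "rate \<mu> u = (if u \<ge> \<mu> then u * ln (u / \<mu>) - u + \<mu> else 0)"

definition threshold :: "nat \<Rightarrow> real \<Rightarrow> real" where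
  "threshold n d = sqrt d / real n"

text \<open>
  For \<open>1 \<le> d < n\<^sup>2\<close> the threshold lies in \<open>(0,1)\<close>, so the floor below is nonnegative and
  \<open>nat\<close> does not truncate.
\<close>

definition num_labels :: "nat \<Rightarrow> real \<Rightarrow> nat" where
  "num_labels n d = 1 + nat \<lfloor>log 2 (1 / threshold n d)\<rfloor>"

text \<open>
  A labeled partial partition in one mode is given by its set \<open>A\<close> of assigned labels and the
  sets \<open>D l\<close> for \<open>l \<in> A\<close>.
\<close>

definition labeled_partial_partition ::
    "nat \<Rightarrow> nat \<Rightarrow> nat set \<Rightarrow> (nat \<Rightarrow> nat set) \<Rightarrow> bool" where
  "labeled_partial_partition n L A D \<longleftrightarrow>
     A \<subseteq> {0..<L} \<and> (\<forall>l\<in>A. D l \<noteq> {} \<and> D l \<subseteq> {1..n}) \<and> disjoint_family_on D A"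

definition box_labels :: "nat \<Rightarrow> (nat \<Rightarrow> nat set) \<Rightarrow> (nat \<Rightarrow> nat) set" where
  "box_labels k A = (\<Pi>\<^sub>E j\<in>{1..k}. A j)"

definition label_box :: "nat \<Rightarrow> (nat \<Rightarrow> nat \<Rightarrow> nat set) \<Rightarrow> (nat \<Rightarrow> nat) \<Rightarrow> (nat \<Rightarrow> nat) set" where
  "label_box k D b = (\<Pi>\<^sub>E j\<in>{1..k}. D j (b j))"

definition set_entropy :: "nat \<Rightarrow> nat set \<Rightarrow> real" where
  "set_entropy n S = real (card S) * ln (exp 1 * real n / real (card S))"

definition label_entropy ::
    "nat \<Rightarrow> nat \<Rightarrow> (nat \<Rightarrow> nat \<Rightarrow> nat set) \<Rightarrow> (nat \<Rightarrow> nat) set \<Rightarrow> real" where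
  "label_entropy k n D B = (\<Sum>j\<in>{1..k}. \<Sum>l\<in>(\<lambda>b. b j) ` B. set_entropy n (D j l))"

definition box_rate ::
    "nat \<Rightarrow> nat \<Rightarrow> real \<Rightarrow> ((nat \<Rightarrow> nat) \<Rightarrow> real) \<Rightarrow> (nat \<Rightarrow> nat \<Rightarrow> nat set) \<Rightarrow> (nat \<Rightarrow> nat) \<Rightarrow> real" where
  "box_rate k n d t D b =
     rate (d / real n * real (card (label_box k D b))) (entry_sum t (label_box k D b))"

definition unit_tuples :: "nat \<Rightarrow> nat \<Rightarrow> (nat \<Rightarrow> nat \<Rightarrow> real) set" where
  "unit_tuples k n = {x. \<forall>j\<in>{1..k}. L2_set (x j) {1..n} = 1}"

definition heavy :: "nat \<Rightarrow> nat \<Rightarrow> real \<Rightarrow> (nat \<Rightarrow> nat \<Rightarrow> real) \<Rightarrow> (nat \<Rightarrow> nat) set" where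
  "heavy k n \<tau> x = {i \<in> multi_indices k n. (\<Prod>j\<in>{1..k}. \<bar>x j (i j)\<bar>) > \<tau>}"

end

theory Submission
  imports Defs
begin

text \<open>
  Cut each \<open>\<bar>x j\<bar>\<close> into dyadic levels; \<open>p j l\<close> is the size of level \<open>l\<close>, so
  \<open>\<Sum>l. p j l / 4^l \<le> 4\<close>. A box \<open>b\<close> contributes at most \<open>e b * \<alpha> b\<close> with \<open>\<alpha> b = 2^-(\<Sum>j. b j) > \<tau>\<close>.
  Boxes with \<open>e b \<le> exp 2 * (\<alpha> b / \<tau>) * \<mu> b\<close> sum to \<open>O(sqrt d)\<close> directly. If one label exceeds the sum
  of the others by more than \<open>log\<^sub>2 (sqrt d)\<close>, the fiber degrees give a geometric series. For the
  remaining boxes the rate is at least \<open>e b * (2 + ln (\<alpha> b / \<tau>)) / 2\<close>, and the entropy hypothesis is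
  applied with the weights \<open>\<alpha> b / (2 + ln (\<alpha> b / \<tau>))\<close>: each level set is then charged its entropy
  times the largest weight of a box using it, which is \<open>O(sqrt d)\<close> times a summable sequence.
  The term \<open>ln (e L)\<close> is \<open>O(sqrt d)\<close> because \<open>L = O(1 + ln n) = O(d)\<close>.
\<close>

section \<open>Geometric sums, a layer-cake inequality and scalar estimates\<close>

lemma sum_half_powers_le:
  fixes z :: real
  assumes "finite X" and "z \<ge> 0" and "\<And>l. l \<in> X \<Longrightarrow> (1/2)^l \<le> z"
  shows "(\<Sum>l\<in>X. (1/2)^l) \<le> 2 * z"
proof (cases "X = {}")
  case False
  define m where "m = Min X"
  have m: "m \<in> X" using False assms(1) by (simp add: m_def)
  have geom: "(\<Sum>l\<in>{m..<m+q}. (1/2::real)^l) = 2 * (1/2)^m - 2 * (1/2)^(m+q)" for q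
    by (induction q) auto
  have "X \<subseteq> {m..<m + Suc (Max X)}"
    using assms(1) by (auto simp: m_def less_Suc_eq_le trans_le_add2)
  then have "(\<Sum>l\<in>X. (1/2::real)^l) \<le> (\<Sum>l\<in>{m..<m + Suc (Max X)}. (1/2)^l)"
    by (intro sum_mono2) auto
  also have "\<dots> \<le> 2 * (1/2)^m"
    unfolding geom by simp
  finally show ?thesis using assms(3)[OF m] by simp
qed (use assms in simp)

lemma sum_two_powers_le:
  fixes z :: real
  assumes "finite X" and "z \<ge> 0" and "\<And>l. l \<in> X \<Longrightarrow> 2^l \<le> z"
  shows "(\<Sum>l\<in>X. 2^l) \<le> 2 * z"
proof (cases "X = {}")
  case False
  define m where "m = Max X"
  have m: "m \<in> X" using False assms(1) by (simp add: m_def)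
  have geom: "(\<Sum>l<q. (2::real)^l) = 2^q - 1" for q
    by (induction q) auto
  have "X \<subseteq> {..<Suc m}"
    using assms(1) by (auto simp: m_def less_Suc_eq_le)
  then have "(\<Sum>l\<in>X. (2::real)^l) \<le> (\<Sum>l<Suc m. 2^l)"
    by (intro sum_mono2) auto
  also have "\<dots> \<le> 2 * 2^m"
    unfolding geom by simp
  finally show ?thesis using assms(3)[OF m] by simp
qed (use assms in simp)

text \<open>
  A layer-cake argument: an upper bound for \<open>\<Sum>b\<in>B. f b\<close> over all \<open>B\<close> that charges \<open>h i\<close> once
  for each \<open>i\<close> hit by \<open>B\<close> passes to weighted sums, the charge then being the largest weight.
  Subtracting the least weight from all weights drives the induction.
\<close>

lemma weighted_sum_le_charges:
  fixes f w :: "'b \<Rightarrow> real" and h M :: "'i \<Rightarrow> real" and P :: "'i \<Rightarrow> 'b \<Rightarrow> bool"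
  assumes "finite G" and X: "finite X" and h: "\<And>i. i \<in> X \<Longrightarrow> h i \<ge> 0"
    and bound: "\<And>B. B \<noteq> {} \<Longrightarrow> B \<subseteq> G \<Longrightarrow>
      (\<Sum>b\<in>B. f b) \<le> K * ((\<Sum>i\<in>{i\<in>X. \<exists>b\<in>B. P i b}. h i) + real (card B) * \<Lambda>)"
    and "K \<ge> 0"
    and "\<And>b. b \<in> G \<Longrightarrow> w b \<ge> 0" and "\<And>i. i \<in> X \<Longrightarrow> M i \<ge> 0"
    and "\<And>i b. i \<in> X \<Longrightarrow> b \<in> G \<Longrightarrow> P i b \<Longrightarrow> w b \<le> M i"
  shows "(\<Sum>b\<in>G. w b * f b) \<le> K * ((\<Sum>i\<in>X. h i * M i) + \<Lambda> * (\<Sum>b\<in>G. w b))"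
  using assms(1,4,6-)
proof (induction "card G" arbitrary: G w M)
  case 0
  then show ?case using h \<open>K \<ge> 0\<close> by (auto intro!: mult_nonneg_nonneg sum_nonneg)
next
  case (Suc q)
  have fin: "finite G" and ne: "G \<noteq> {}" using Suc.hyps(2) Suc.prems(1) by auto
  obtain b0 where b0: "b0 \<in> G" and min: "\<And>b. b \<in> G \<Longrightarrow> w b0 \<le> w b"
    using arg_min_if_finite[OF fin ne, of w] by (metis not_le)
  define m where "m = w b0"
  \<comment> \<open>After subtraction of the least weight, \<open>b0\<close> has weight zero and
    drops out.\<close>
  define G' where "G' = G - {b0}"
  define w' where "w' = (\<lambda>b. w b - m)"
  define hit where "hit = {i\<in>X. \<exists>b\<in>G. P i b}"
  \<comment> \<open>Only the charges hit by \<open>G\<close> shrink. Their total decrease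
    \<open>m * (\<Sum>i\<in>hit. h i)\<close> is what the unweighted bound for all of
    \<open>G\<close>, multiplied by \<open>m\<close>, adds back.\<close>
  define M' where "M' = (\<lambda>i. if i \<in> hit then M i - m else M i)"
  have m0: "m \<ge> 0" using Suc.prems(3) b0 by (simp add: m_def)
  have IH: "(\<Sum>b\<in>G'. w' b * f b) \<le> K * ((\<Sum>i\<in>X. h i * M' i) + \<Lambda> * (\<Sum>b\<in>G'. w' b))"
  proof (rule Suc.hyps(1))
    show "q = card G'" using Suc.hyps(2) b0 fin by (simp add: G'_def)
    show "finite G'" using fin by (simp add: G'_def)
    show "(\<Sum>b\<in>B. f b) \<le> K * ((\<Sum>i\<in>{i\<in>X. \<exists>b\<in>B. P i b}. h i) + real (card B) * \<Lambda>)"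
      if "B \<noteq> {}" "B \<subseteq> G'" for B
      using that by (intro Suc.prems(2)) (auto simp: G'_def)
    show "w' b \<ge> 0" if "b \<in> G'" for b
      using min that by (auto simp: w'_def m_def G'_def)
    show "M' i \<ge> 0" if "i \<in> X" for i
    proof (cases "i \<in> hit")
      case True
      then obtain b where "b \<in> G" "P i b" by (auto simp: hit_def)
      then show ?thesis using Suc.prems(5)[OF that] min[of b] True
        by (force simp: M'_def m_def)
    next
      case False
      then show ?thesis using Suc.prems(4)[OF that] by (simp add: M'_def)
    qed
    show "w' b \<le> M' i" if "i \<in> X" "b \<in> G'" "P i b" for i b
      using that Suc.prems(5)[of i b] by (auto simp: w'_def M'_def hit_def G'_def)
  qed
  have split: "(\<Sum>b\<in>G. g b) = (\<Sum>b\<in>G'. g b)" if "g b0 = 0" for g :: "'b \<Rightarrow> real"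
    using that fin b0 by (simp add: G'_def sum.remove)
  have "(\<Sum>b\<in>G. w b * f b) = m * (\<Sum>b\<in>G. f b) + (\<Sum>b\<in>G. w' b * f b)"
    by (simp add: w'_def algebra_simps sum_subtractf sum_distrib_left)
  also have "(\<Sum>b\<in>G. w' b * f b) = (\<Sum>b\<in>G'. w' b * f b)"
    by (rule split) (simp add: w'_def m_def)
  also have "m * (\<Sum>b\<in>G. f b) \<le> m * (K * ((\<Sum>i\<in>hit. h i) + real (card G) * \<Lambda>))"
    unfolding hit_def using Suc.prems(2)[of G] ne m0 by (intro mult_left_mono) auto
  also note IH
  also have "(\<Sum>i\<in>X. h i * M' i) = (\<Sum>i\<in>X. h i * M i) - m * (\<Sum>i\<in>hit. h i)"
  proof -
    have "h i * M' i = h i * M i - (if i \<in> hit then m * h i else 0)" for i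
      by (simp add: M'_def algebra_simps)
    moreover have "X \<inter> hit = hit" by (auto simp: hit_def)
    ultimately show ?thesis
      using X by (simp add: sum_subtractf sum_distrib_left flip: sum.inter_restrict)
  qed
  also have "(\<Sum>b\<in>G'. w' b) = (\<Sum>b\<in>G. w' b)"
    by (rule split[symmetric]) (simp add: w'_def m_def)
  also have "(\<Sum>b\<in>G. w' b) = (\<Sum>b\<in>G. w b) - real (card G) * m"
    by (simp add: w'_def sum_subtractf)
  finally show ?case by (simp add: algebra_simps)
qed

text \<open>
  Used with \<open>N = n / 4^l\<close>, \<open>a = p j l / 4^l\<close> and \<open>y * N = \<alpha> b / \<tau>\<close>. For \<open>a < 1 / N\<close> the factor
  \<open>a * ln (1 / a)\<close> is not \<open>O(a)\<close>; there it is \<open>O(sqrt a)\<close>, which is summable over \<open>l\<close> as \<open>1 / sqrt N\<close> is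
  geometric in \<open>l\<close>.
\<close>

lemma entropy_term_le:
  fixes a N y :: real
  assumes "a > 0" and "0 < y" "y \<le> 1" and "y * N \<ge> 1"
  shows "a * ln (exp 1 * N / a) * y \<le> (2 * a + 2 / sqrt N) * (2 + ln (y * N))"
proof -
  have N: "N \<ge> 1" using assms by (smt (verit) mult_le_one mult_nonneg_nonpos mult_less_cancel_right1)
  have R: "ln (y * N) \<ge> 0" using assms by simp
  have ln_eq: "ln (exp 1 * N / a) = 1 + ln N - ln a"
    using N assms by (simp add: ln_div ln_mult)
  show ?thesis
  proof (cases "a \<ge> 1 / N")
    case True
    then have "ln (1 / N) \<le> ln a" using N assms(1) by (subst ln_le_cancel_iff) auto
    then have "ln (exp 1 * N / a) \<le> 1 + 2 * ln N"
      unfolding ln_eq using N by (simp add: ln_div)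
    then have "ln (exp 1 * N / a) * y \<le> (1 + 2 * ln N) * y"
      using assms by (intro mult_right_mono) auto
    \<comment> \<open>Writing \<open>ln N = ln (y * N) + ln (1 / y)\<close> isolates the ratio; the
      remainder \<open>y * ln (1 / y)\<close> is at most 1.\<close>
    also have "\<dots> = y + 2 * (y * ln (y * N)) + 2 * (y * ln (1 / y))"
      using N assms by (simp add: ln_mult ln_div algebra_simps)
    also have "\<dots> \<le> 1 + 2 * ln (y * N) + 2 * 1"
    proof -
      have "y * ln (y * N) \<le> ln (y * N)" using R assms by (simp add: mult_left_le_one_le)
      moreover have "y * ln (1 / y) \<le> y * (1 / y)"
        using assms ln_le_minus_one[of "1 / y"] by (intro mult_left_mono) auto
      ultimately show ?thesis using assms by simp
    qed
    also have "\<dots> \<le> 2 * (2 + ln (y * N))" by simp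
    finally have "a * (ln (exp 1 * N / a) * y) \<le> a * (2 * (2 + ln (y * N)))"
      using assms by (intro mult_left_mono) auto
    also have "\<dots> \<le> (2 * a + 2 / sqrt N) * (2 + ln (y * N))"
      using N R by (simp add: algebra_simps)
    finally show ?thesis by (simp add: mult.assoc)
  next
    case False
    then have aN: "a * N < 1" using N by (simp add: field_simps)
    then have "ln (a * N) \<le> ln 1" using N assms by (subst ln_le_cancel_iff) auto
    then have "ln N \<le> - ln a" using N assms by (simp add: ln_mult)
    \<comment> \<open>Writing \<open>- 2 * ln a\<close> as \<open>4 * ln (1 / sqrt a)\<close> lets
      \<open>ln z \<le> z - 1\<close> produce \<open>1 / sqrt a\<close>, which costs only
      \<open>sqrt a\<close> after multiplication by \<open>a\<close>.\<close>
    then have "ln (exp 1 * N / a) \<le> 1 + 4 * ln (1 / sqrt a)"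
      unfolding ln_eq using assms by (simp add: ln_div ln_sqrt)
    also have "\<dots> \<le> 1 + 4 * (1 / sqrt a)"
      using assms ln_le_minus_one[of "1 / sqrt a"] by simp
    finally have "a * ln (exp 1 * N / a) \<le> a * (1 + 4 * (1 / sqrt a))"
      using assms by (intro mult_left_mono) auto
    also have "\<dots> = a + 4 * sqrt a"
      using assms by (simp add: field_simps)
    also have "\<dots> \<le> 2 * (2 * a + 2 / sqrt N)"
    proof -
      have "sqrt (a * N) \<le> 1" using aN by simp
      then have "sqrt a \<le> 1 / sqrt N" using N by (simp add: real_sqrt_mult field_simps)
      then show ?thesis using assms by simp
    qed
    finally have 1: "a * ln (exp 1 * N / a) \<le> (2 * a + 2 / sqrt N) * 2" by simp
    have "a * ln (exp 1 * N / a) * y \<le> (2 * a + 2 / sqrt N) * 2 * y"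
      using 1 assms by (intro mult_right_mono) auto
    also have "\<dots> \<le> (2 * a + 2 / sqrt N) * 2"
      using assms N by (intro mult_left_le) auto
    also have "\<dots> \<le> (2 * a + 2 / sqrt N) * (2 + ln (y * N))"
      using R N assms by (intro mult_left_mono) auto
    finally show ?thesis .
  qed
qed

text \<open>As \<open>ln (u / \<mu>) \<ge> 2 + ln r\<close>, the rate is at least
  \<open>u * (1 + ln r)\<close>, which dominates half of \<open>u * (2 + ln r)\<close>. The factor
  \<open>exp 2\<close> leaves room to absorb the term \<open>- u\<close>.\<close>

lemma rate_lower_bound:
  assumes "\<mu> > 0" and "r \<ge> 1" and u: "exp 2 * r * \<mu> \<le> u"
  shows "u * (2 + ln r) / 2 \<le> rate \<mu> u"
proof -
  have "1 * 1 * \<mu> \<le> exp 2 * r * \<mu>"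
    using assms by (intro mult_right_mono mult_mono) auto
  then have \<mu>u: "\<mu> \<le> u" using u by simp
  have "exp 2 * r \<le> u / \<mu>" using assms by (simp add: field_simps)
  then have "ln (exp 2 * r) \<le> ln (u / \<mu>)"
    using assms \<mu>u by (subst ln_le_cancel_iff) auto
  then have "2 + ln r \<le> ln (u / \<mu>)"
    using assms by (simp add: ln_mult)
  then have "u * (2 + ln r) \<le> u * ln (u / \<mu>)"
    using assms \<mu>u by (intro mult_left_mono) auto
  moreover have "u * 0 \<le> u * ln r"
    using assms \<mu>u by (intro mult_left_mono) auto
  moreover have "rate \<mu> u = u * ln (u / \<mu>) - u + \<mu>" "u * (2 + ln r) = 2 * u + u * ln r"
    using \<mu>u by (simp_all add: rate_def algebra_simps)
  ultimately show ?thesis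
    using assms(1) by linarith
qed

section \<open>Sums over boxes of levels\<close>

lemma sum_PiE_insert:
  assumes "j \<notin> J"
  shows "(\<Sum>b\<in>PiE (insert j J) A. F b) = (\<Sum>g\<in>PiE J A. \<Sum>l\<in>A j. F (g(j := l)))"
proof -
  have "(\<Sum>b\<in>PiE (insert j J) A. F b) = (\<Sum>(l, g)\<in>A j \<times> PiE J A. F (g(j := l)))"
    unfolding PiE_insert_eq
    by (subst sum.reindex) (auto intro: inj_combinator[OF assms] simp: case_prod_beta)
  also have "\<dots> = (\<Sum>l\<in>A j. \<Sum>g\<in>PiE J A. F (g(j := l)))"
    by (simp add: sum.cartesian_product)
  finally show ?thesis by (subst sum.swap) simp
qed

text \<open>The product of the upper endpoints of the dyadic levels; this is
  \<open>\<alpha> b\<close> in the overview.\<close>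

definition box_scale :: "'j set \<Rightarrow> ('j \<Rightarrow> nat) \<Rightarrow> real" where
  "box_scale J b = (\<Prod>j\<in>J. (1/2)^b j)"

lemma box_scale_pos: "box_scale J b > 0"
  by (simp add: box_scale_def prod_pos)

lemma box_scale_remove:
  "finite J \<Longrightarrow> j \<in> J \<Longrightarrow> box_scale J b = (1/2)^b j * box_scale (J - {j}) b"
  unfolding box_scale_def by (rule prod.remove)

text \<open>The sum factors into one geometric series per mode. It bounds the total weight
  multiplying \<open>\<Lambda>\<close>, independently of the number of levels.\<close>

lemma sum_box_scale_le:
  assumes "finite J" and "\<And>j. j \<in> J \<Longrightarrow> finite (A j)"
  shows "(\<Sum>b\<in>PiE J A. box_scale J b) \<le> 2 ^ card J"
proof -
  have "(\<Sum>b\<in>PiE J A. box_scale J b) = (\<Prod>j\<in>J. \<Sum>l\<in>A j. (1/2)^l)"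
    unfolding box_scale_def using assms by (subst prod_sum_PiE) auto
  also have "\<dots> \<le> (\<Prod>j\<in>J. 2)"
    using assms sum_half_powers_le[of _ 1]
    by (intro prod_mono) (auto simp: sum_nonneg power_le_one)
  finally show ?thesis by simp
qed

text \<open>The square of the scale turns sizes into masses, so that sums over boxes factor over the
  modes.\<close>

lemma prod_mass: "(\<Prod>j\<in>J. p j (b j) * (1/4)^b j) = (\<Prod>j\<in>J. p j (b j)) * (box_scale J b)\<^sup>2"
proof -
  have "(1/4::real)^m = ((1/2)^m)\<^sup>2" for m
    by (simp add: power2_eq_square flip: power_mult_distrib)
  then show ?thesis by (simp add: box_scale_def prod.distrib prod_power_distrib)
qed

text \<open>Vectors and tensor are forgotten: only the level sizes \<open>p\<close> remain, and box
  counts enter later as a function \<open>e\<close>. The bound 4 is the unit norm times the square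
  of the ratio 2 of dyadic endpoints.\<close>

locale level_masses =
  fixes I :: "'j set" and A :: "'j \<Rightarrow> nat set" and p :: "'j \<Rightarrow> nat \<Rightarrow> real"
  assumes finite_modes: "finite I"
    and finite_levels: "\<And>j. j \<in> I \<Longrightarrow> finite (A j)"
    and pos: "\<And>j l. j \<in> I \<Longrightarrow> l \<in> A j \<Longrightarrow> p j l > 0"
    and mass: "\<And>j. j \<in> I \<Longrightarrow> (\<Sum>l\<in>A j. p j l * (1/4)^l) \<le> 4"
begin

lemma prod_mass_nonneg:
  assumes "J \<subseteq> I" and "\<And>j. j \<in> J \<Longrightarrow> b j \<in> A j"
  shows "(\<Prod>j\<in>J. p j (b j) * (1/4)^b j) \<ge> 0"
  using assms pos by (intro prod_nonneg) (force intro: mult_nonneg_nonneg less_imp_le)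

lemma finite_boxes: "finite (PiE I A)"
  by (intro finite_PiE finite_modes finite_levels)

lemma sum_prod_mass_le:
  assumes "J \<subseteq> I"
  shows "(\<Sum>b\<in>PiE J A. \<Prod>j\<in>J. p j (b j) * (1/4)^b j) \<le> 4 ^ card J"
proof -
  have J: "finite J" using assms finite_modes finite_subset by blast
  have "(\<Sum>b\<in>PiE J A. \<Prod>j\<in>J. p j (b j) * (1/4)^b j) = (\<Prod>j\<in>J. \<Sum>l\<in>A j. p j l * (1/4)^l)"
    using J assms finite_levels by (subst prod_sum_PiE) auto
  also have "\<dots> \<le> (\<Prod>j\<in>J. 4)"
    using assms mass
    by (intro prod_mono conjI sum_nonneg mult_nonneg_nonneg) (auto intro: less_imp_le[OF pos])
  finally show ?thesis by simp
qed

text \<open>A light box contributes at most \<open>c * s\<close> times its product mass: one factor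
  of the scale comes from the density bound, the other from the contribution, and \<open>n\<close>
  cancels.\<close>

lemma light_boxes_le:
  assumes "s > 0" and "n > 0"
    and "S \<subseteq> PiE I A"
    and "\<And>b. b \<in> S \<Longrightarrow> e b \<le> c * (box_scale I b / (s / n)) * (s\<^sup>2 / n * (\<Prod>j\<in>I. p j (b j)))"
    and "c \<ge> 0"
  shows "(\<Sum>b\<in>S. e b * box_scale I b) \<le> c * 4 ^ card I * s"
proof -
  have "e b * box_scale I b \<le> c * s * (\<Prod>j\<in>I. p j (b j) * (1/4)^b j)" if "b \<in> S" for b
  proof -
    have "e b * box_scale I b \<le>
        c * (box_scale I b / (s / n)) * (s\<^sup>2 / n * (\<Prod>j\<in>I. p j (b j))) * box_scale I b"
      using assms that box_scale_pos[of I b] by (intro mult_right_mono) auto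
    also have "\<dots> = c * s * ((\<Prod>j\<in>I. p j (b j)) * (box_scale I b)\<^sup>2)"
      using assms by (simp add: power2_eq_square field_simps)
    finally show ?thesis by (simp only: prod_mass)
  qed
  then have "(\<Sum>b\<in>S. e b * box_scale I b) \<le> (\<Sum>b\<in>S. c * s * (\<Prod>j\<in>I. p j (b j) * (1/4)^b j))"
    by (rule sum_mono)
  also have "\<dots> \<le> (\<Sum>b\<in>PiE I A. c * s * (\<Prod>j\<in>I. p j (b j) * (1/4)^b j))"
    using assms finite_boxes
    by (intro sum_mono2 mult_nonneg_nonneg prod_mass_nonneg) (auto simp: PiE_iff)
  also have "\<dots> \<le> c * s * 4 ^ card I"
    using sum_prod_mass_le[of I] assms
    by (auto simp flip: sum_distrib_left intro!: mult_left_mono)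
  finally show ?thesis by (simp add: mult_ac)
qed

text \<open>
  If \<open>b j\<close> exceeds the sum of the other labels by more than \<open>log\<^sub>2 s\<close>, the fiber bound in
  direction \<open>j\<close> decays geometrically in \<open>b j\<close>.
\<close>

lemma unbalanced_boxes_le:
  assumes "j \<in> I" and "s > 0" and "c \<ge> 0"
    and S: "\<And>b. b \<in> S \<Longrightarrow> b \<in> PiE I A \<and> (1/2)^b j * s < box_scale (I - {j}) b"
    and e: "\<And>b. b \<in> S \<Longrightarrow> e b \<le> c * (\<Prod>m\<in>I - {j}. p m (b m))"
  shows "(\<Sum>b\<in>S. e b * box_scale I b) \<le> 2 * c / s * 4 ^ card I"
proof -
  define J where "J = I - {j}"
  have I: "I = insert j J" and "j \<notin> J" using assms(1) by (auto simp: J_def)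
  define m where "m = (\<lambda>b. \<Prod>m\<in>J. p m (b m) * (1/4)^b m)"
  \<comment> \<open>The fiber bound has no size factor in mode \<open>j\<close>, so \<open>m\<close>
    collects the masses of the other modes; their second power of the scale has to be divided out.
    The indicator retains the cutoff that controls the sum over \<open>b j\<close>.\<close>
  define F where "F = (\<lambda>b. if (1/2)^b j * s < box_scale J b then c * m b / box_scale J b * (1/2)^b j else 0)"
  have m0: "m b \<ge> 0" if "b \<in> PiE J A" for b
    unfolding m_def using that by (intro prod_mass_nonneg) (auto simp: I PiE_iff)
  have upd: "m (g(j := l)) = m g" "box_scale J (g(j := l)) = box_scale J g" for g l
    unfolding m_def box_scale_def using \<open>j \<notin> J\<close> by (auto intro!: prod.cong)
  have F0: "F b \<ge> 0" if "b \<in> PiE I A" for b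
  proof -
    have "m b \<ge> 0"
      unfolding m_def using that by (intro prod_mass_nonneg) (auto simp: I PiE_iff)
    then show ?thesis using box_scale_pos[of J b] assms(3) by (auto simp: F_def)
  qed
  have "(\<Sum>b\<in>S. e b * box_scale I b) \<le> (\<Sum>b\<in>S. F b)"
  proof (rule sum_mono)
    fix b assume b: "b \<in> S"
    have "e b * box_scale I b \<le> c * (\<Prod>m\<in>J. p m (b m)) * box_scale I b"
      using e[OF b] box_scale_pos[of I b] by (intro mult_right_mono) (auto simp: J_def)
    also have "\<dots> = c * m b / box_scale J b * (1/2)^b j"
      using box_scale_pos[of J b] box_scale_remove[OF finite_modes assms(1), of b]
      by (simp add: m_def prod_mass power2_eq_square J_def)
    also have "\<dots> = F b" using S[OF b] by (simp add: F_def J_def)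
    finally show "e b * box_scale I b \<le> F b" .
  qed
  also have "\<dots> \<le> (\<Sum>b\<in>PiE I A. F b)"
    using S F0 finite_boxes by (intro sum_mono2) auto
  also have "\<dots> = (\<Sum>g\<in>PiE J A. \<Sum>l\<in>A j. F (g(j := l)))"
    unfolding I by (rule sum_PiE_insert) fact
  also have "\<dots> \<le> (\<Sum>g\<in>PiE J A. 2 * c / s * m g)"
  proof (rule sum_mono)
    fix g assume g: "g \<in> PiE J A"
    define z where "z = box_scale J g"
    have z: "z > 0" by (simp add: z_def box_scale_pos)
    have fin: "finite {l \<in> A j. (1/2)^l * s < z}"
      using finite_levels assms(1) by simp
    have "(\<Sum>l\<in>A j. F (g(j := l))) = (\<Sum>l\<in>{l\<in>A j. (1/2)^l * s < z}. c * m g / z * (1/2)^l)"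
      using finite_levels[OF assms(1)]
      by (simp add: F_def upd z_def flip: sum.inter_filter)
    also have "\<dots> = c * m g / z * (\<Sum>l\<in>{l\<in>A j. (1/2)^l * s < z}. (1/2)^l)"
      by (rule sum_distrib_left[symmetric])
    \<comment> \<open>The cutoff bounds each term by \<open>z / s\<close>, and this \<open>z\<close>
      cancels the denominator.\<close>
    also have "\<dots> \<le> c * m g / z * (2 * (z / s))"
      using z assms m0[OF g] fin
      by (intro mult_left_mono sum_half_powers_le) (auto simp: pos_le_divide_eq)
    also have "\<dots> = 2 * c / s * m g" using z by simp
    finally show "(\<Sum>l\<in>A j. F (g(j := l))) \<le> 2 * c / s * m g" .
  qed
  also have "\<dots> \<le> 2 * c / s * 4 ^ card J"
    unfolding sum_distrib_left[symmetric]
    using sum_prod_mass_le[of J] assms(2,3)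
    by (intro mult_left_mono) (auto simp: m_def I)
  also have "\<dots> \<le> 2 * c / s * 4 ^ card I"
    using assms finite_modes
    by (intro mult_left_mono power_increasing card_mono) (auto simp: J_def)
  finally show ?thesis .
qed

text \<open>The weights \<open>w\<close> cancel the logarithmic factor of
  \<open>rate_lower_bound\<close>. Balance supplies \<open>y \<le> 1\<close> for
  \<open>entropy_term_le\<close>, which caps \<open>h (j, l) * w b\<close> by a quantity depending
  only on the level \<open>(j, l)\<close>.\<close>

lemma dense_balanced_boxes_le:
  assumes "s > 0" and "n > 0" and "\<Lambda> \<ge> 0" and "K \<ge> 0"
    and p_le: "\<And>j l. j \<in> I \<Longrightarrow> l \<in> A j \<Longrightarrow> p j l \<le> n"
    and G: "\<And>b. b \<in> G \<Longrightarrow> b \<in> PiE I A"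
    and heavy: "\<And>b. b \<in> G \<Longrightarrow> s / n < box_scale I b"
    and balanced: "\<And>b j. b \<in> G \<Longrightarrow> j \<in> I \<Longrightarrow> box_scale (I - {j}) b \<le> (1/2)^b j * s"
    and dense: "\<And>b. b \<in> G \<Longrightarrow>
      exp 2 * (box_scale I b / (s / n)) * (s\<^sup>2 / n * (\<Prod>j\<in>I. p j (b j))) \<le> e b"
    and rates: "\<And>B. B \<noteq> {} \<Longrightarrow> B \<subseteq> G \<Longrightarrow>
      (\<Sum>b\<in>B. rate (s\<^sup>2 / n * (\<Prod>j\<in>I. p j (b j))) (e b)) \<le>
        K * ((\<Sum>j\<in>I. \<Sum>l\<in>(\<lambda>b. b j) ` B. p j l * ln (exp 1 * n / p j l)) + real (card B) * \<Lambda>)"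
  shows "(\<Sum>b\<in>G. e b * box_scale I b) \<le> 2 * K * (12 * real (card I) * s + 2 ^ card I * \<Lambda>)"
proof -
  define r where "r = (\<lambda>b. box_scale I b / (s / n))"
  define w where "w = (\<lambda>b. box_scale I b / (2 + ln (r b)))"
  define f where "f = (\<lambda>b. rate (s\<^sup>2 / n * (\<Prod>j\<in>I. p j (b j))) (e b))"
  define h where "h = (\<lambda>(j, l). p j l * ln (exp 1 * n / p j l))"
  \<comment> \<open>This is \<open>s\<close> times the bound of \<open>entropy_term_le\<close>
    without its logarithmic factor. The cutoff is harmless: heaviness and balance force
    \<open>N > 1\<close>, that is \<open>4^l < n\<close>, for every level used by a box in
    \<open>G\<close>.\<close>
  define F where "F = (\<lambda>(j, l). if 2^l \<le> sqrt n then s * (2 * (p j l * (1/4)^l) + 2 * 2^l / sqrt n) else 0)"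
  \<comment> \<open>The entropies \<open>h i\<close> are positive on \<open>Sigma I A\<close>, so
    the charge \<open>h i * M i\<close> equals \<open>F i\<close>.\<close>
  define M where "M = (\<lambda>i. F i / h i)"
  have finG: "finite G" by (rule finite_subset[OF _ finite_boxes]) (use G in auto)
  have r1: "r b > 1" if "b \<in> G" for b
    using heavy[OF that] assms(1,2) by (simp add: r_def field_simps)
  have ln_r: "ln (r b) > 0" if "b \<in> G" for b
    by (rule ln_gt_zero) (rule r1[OF that])
  have h0: "h (j, l) > 0" if "j \<in> I" "l \<in> A j" for j l
  proof -
    have "1 * p j l < exp 1 * n"
      using p_le[OF that] pos[OF that] assms(2) by (intro mult_less_le_imp_less) auto
    then show ?thesis using pos[OF that] by (simp add: h_def)
  qed
  have w0: "w b \<ge> 0" if "b \<in> G" for b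
    using ln_r[OF that] box_scale_pos[of I b] by (simp add: w_def)
  have w_le: "h (j, b j) * w b \<le> F (j, b j)" if b: "b \<in> G" and j: "j \<in> I" for b j
  proof -
    define l where "l = b j"
    define a where "a = p j l * (1/4)^l"
    define N where "N = n * (1/4)^l"
    \<comment> \<open>The ratio of the two sides of the balance condition. It satisfies
      \<open>y * N = r b\<close>, and \<open>s * a * y\<close> is
      \<open>p j l * box_scale I b\<close>.\<close>
    define y where "y = box_scale (I - {j}) b / ((1/2)^l * s)"
    have l: "l \<in> A j" using G[OF b] j by (auto simp: l_def)
    note posl = pos[OF j l]
    have quarter: "(1/4::real)^m = (1/2)^m * (1/2)^m" for m
      by (simp flip: power_mult_distrib)
    have yN: "y * N = r b"
      using assms(1,2) box_scale_remove[OF finite_modes j, of b]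
      by (simp add: y_def N_def r_def l_def quarter)
    have y: "0 < y" "y \<le> 1"
      using balanced[OF b j] assms(1) box_scale_pos[of "I - {j}" b] by (auto simp: y_def l_def)
    have "1 < N" using r1[OF b] y yN by (smt (verit) mult_left_le_one_le mult_nonneg_nonpos)
    have "sqrt N = sqrt n * (1/2)^l"
      unfolding N_def quarter by (simp add: real_sqrt_mult)
    then have sqrtN: "sqrt N = sqrt n / 2^l"
      by (simp add: power_one_over)
    have F: "F (j, l) = s * (2 * a + 2 / sqrt N)"
    proof -
      have "1 < sqrt N" using \<open>1 < N\<close> by simp
      then have "2^l < sqrt n" unfolding sqrtN by (simp add: field_simps)
      then show ?thesis by (simp add: F_def a_def sqrtN)
    qed
    have R: "2 + ln (r b) > 0" using ln_r[OF b] by simp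
    have "a * ln (exp 1 * N / a) * y \<le> (2 * a + 2 / sqrt N) * (2 + ln (y * N))"
      using y posl r1[OF b] by (intro entropy_term_le) (auto simp: a_def yN)
    then have "s * (a * ln (exp 1 * N / a) * y) \<le> s * ((2 * a + 2 / sqrt N) * (2 + ln (y * N)))"
      using assms(1) by (intro mult_left_mono) auto
    also have "\<dots> = F (j, l) * (2 + ln (r b))" by (simp add: F yN)
    also have "s * (a * ln (exp 1 * N / a) * y) = h (j, l) * box_scale I b"
    proof -
      have "exp 1 * N / a = exp 1 * n / p j l" using posl by (simp add: N_def a_def)
      moreover have "s * a * y = p j l * box_scale I b"
        using assms(1) box_scale_remove[OF finite_modes j, of b]
        by (simp add: a_def y_def l_def quarter)
      ultimately show ?thesis by (simp add: h_def mult_ac)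
    qed
    finally show ?thesis using R by (simp add: w_def l_def pos_divide_le_eq)
  qed
  have "(\<Sum>b\<in>G. e b * box_scale I b) \<le> (\<Sum>b\<in>G. 2 * (w b * f b))"
  proof (rule sum_mono)
    fix b assume b: "b \<in> G"
    have R: "2 + ln (r b) > 0" using ln_r[OF b] by simp
    have "(\<Prod>j\<in>I. p j (b j)) > 0" using G[OF b] pos by (intro prod_pos) auto
    then have "e b * (2 + ln (r b)) / 2 \<le> f b"
      unfolding f_def using r1[OF b] dense[OF b] assms(1,2)
      by (intro rate_lower_bound) (auto simp: r_def)
    then have "w b * (e b * (2 + ln (r b)) / 2) \<le> w b * f b"
      using w0[OF b] by (rule mult_left_mono)
    then show "e b * box_scale I b \<le> 2 * (w b * f b)"
      using R by (simp add: w_def mult_ac)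
  qed
  also have "\<dots> = 2 * (\<Sum>b\<in>G. w b * f b)" by (rule sum_distrib_left[symmetric])
  \<comment> \<open>Charges are indexed by pairs of a mode and a level; a box hits the pairs it
    uses, which reproduces the entropy of a collection.\<close>
  also have "(\<Sum>b\<in>G. w b * f b) \<le> K * ((\<Sum>i\<in>Sigma I A. h i * M i) + \<Lambda> * (\<Sum>b\<in>G. w b))"
  proof (rule weighted_sum_le_charges[where P = "\<lambda>i b. b (fst i) = snd i"])
    show "finite (Sigma I A)" using finite_modes finite_levels by auto
    show "h i \<ge> 0" if "i \<in> Sigma I A" for i
      using that h0 by (auto intro: less_imp_le)
    show "M i \<ge> 0" if "i \<in> Sigma I A" for i
    proof -
      obtain j l where i: "i = (j, l)" "j \<in> I" "l \<in> A j"
        using \<open>i \<in> Sigma I A\<close> by blast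
      have "F (j, l) \<ge> 0" using pos[OF i(2,3)] assms(1,2) by (simp add: F_def)
      then show ?thesis using h0[OF i(2,3)] by (simp add: M_def i(1))
    qed
    show "w b \<le> M i" if "i \<in> Sigma I A" "b \<in> G" "b (fst i) = snd i" for i b
      using that w_le h0 by (auto simp: M_def pos_le_divide_eq mult.commute)
    fix B assume B: "B \<noteq> {}" "B \<subseteq> G"
    have "{i \<in> Sigma I A. \<exists>b\<in>B. b (fst i) = snd i} = Sigma I (\<lambda>j. (\<lambda>b. b j) ` B)"
      using B(2) G by (force simp: PiE_iff)
    moreover have "finite B" using B finG finite_subset by blast
    ultimately show "(\<Sum>b\<in>B. f b) \<le>
        K * ((\<Sum>i\<in>{i \<in> Sigma I A. \<exists>b\<in>B. b (fst i) = snd i}. h i) + real (card B) * \<Lambda>)"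
      using rates[OF B] finite_modes by (simp add: f_def h_def sum.Sigma)
  qed (use finG w0 assms in auto)
  finally have layers: "(\<Sum>b\<in>G. e b * box_scale I b) \<le>
      2 * (K * ((\<Sum>i\<in>Sigma I A. h i * M i) + \<Lambda> * (\<Sum>b\<in>G. w b)))"
    by simp
  have charges: "(\<Sum>i\<in>Sigma I A. h i * M i) \<le> 12 * real (card I) * s"
  proof -
    have "(\<Sum>i\<in>Sigma I A. h i * M i) = (\<Sum>i\<in>Sigma I A. F i)"
      by (rule sum.cong) (auto simp: M_def dest!: h0)
    also have "\<dots> = (\<Sum>j\<in>I. \<Sum>l\<in>A j. F (j, l))"
      using finite_modes finite_levels by (subst sum.Sigma) auto
    also have "\<dots> \<le> (\<Sum>j\<in>I. 12 * s)"
    proof (rule sum_mono)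
      fix j assume j: "j \<in> I"
      define X where "X = {l \<in> A j. 2^l \<le> sqrt n}"
      have X: "finite X" "X \<subseteq> A j" using finite_levels[OF j] by (auto simp: X_def)
      have "(\<Sum>l\<in>A j. F (j, l)) = (\<Sum>l\<in>X. s * (2 * (p j l * (1/4)^l) + 2 * 2^l / sqrt n))"
        using finite_levels[OF j] by (simp add: F_def X_def flip: sum.inter_filter)
      also have "\<dots> = s * (2 * (\<Sum>l\<in>X. p j l * (1/4)^l) + 2 * (\<Sum>l\<in>X. 2^l) / sqrt n)"
        by (simp only: sum.distrib flip: sum_distrib_left sum_divide_distrib)
      \<comment> \<open>The mass gives 4, and the powers \<open>2^l\<close> up to
        \<open>sqrt n\<close> sum to at most \<open>2 * sqrt n\<close>; this is where 12 comes
        from.\<close>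
      also have "\<dots> \<le> s * (2 * 4 + 2 * (2 * sqrt n) / sqrt n)"
      proof -
        have "(\<Sum>l\<in>X. p j l * (1/4)^l) \<le> (\<Sum>l\<in>A j. p j l * (1/4)^l)"
          using X finite_levels[OF j] pos[OF j] by (intro sum_mono2) (auto intro: less_imp_le)
        moreover have "(\<Sum>l\<in>X. (2::real)^l) \<le> 2 * sqrt n"
          using X assms(2) by (intro sum_two_powers_le) (auto simp: X_def)
        ultimately show ?thesis
          using mass[OF j] assms(1,2) by (intro mult_left_mono add_mono divide_right_mono) auto
      qed
      also have "\<dots> = 12 * s" using assms(2) by simp
      finally show "(\<Sum>l\<in>A j. F (j, l)) \<le> 12 * s" .
    qed
    finally show ?thesis by simp
  qed
  have weights: "(\<Sum>b\<in>G. w b) \<le> 2 ^ card I"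
  proof -
    have "(\<Sum>b\<in>G. w b) \<le> (\<Sum>b\<in>G. box_scale I b)"
    proof (rule sum_mono)
      fix b assume b: "b \<in> G"
      have "2 + ln (r b) \<ge> 1" using ln_r[OF b] by simp
      then have "box_scale I b / (2 + ln (r b)) \<le> box_scale I b / 1"
        using box_scale_pos[of I b] by (intro divide_left_mono) auto
      then show "w b \<le> box_scale I b" by (simp add: w_def)
    qed
    also have "\<dots> \<le> (\<Sum>b\<in>PiE I A. box_scale I b)"
      using G finite_boxes by (intro sum_mono2) (auto intro: less_imp_le[OF box_scale_pos])
    also have "\<dots> \<le> 2 ^ card I"
      by (rule sum_box_scale_le[OF finite_modes finite_levels])
    finally show ?thesis .
  qed
  note layers
  also have "2 * (K * ((\<Sum>i\<in>Sigma I A. h i * M i) + \<Lambda> * (\<Sum>b\<in>G. w b))) \<le>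
      2 * (K * (12 * real (card I) * s + \<Lambda> * 2 ^ card I))"
    using assms(3,4) by (intro mult_left_mono add_mono charges weights) auto
  finally show ?thesis by (simp add: mult_ac)
qed

text \<open>Light boxes, boxes unbalanced in some mode and dense balanced boxes cover all heavy
  ones. Overlaps only increase the upper bound, since contributions are nonnegative.\<close>

lemma heavy_boxes_le:
  assumes "s > 0" and "n > 0" and "\<Lambda> \<ge> 0" and "K \<ge> 0" and "c \<ge> 0"
    and p_le: "\<And>j l. j \<in> I \<Longrightarrow> l \<in> A j \<Longrightarrow> p j l \<le> n"
    and e0: "\<And>b. b \<in> PiE I A \<Longrightarrow> e b \<ge> 0"
    and fib: "\<And>b j. b \<in> PiE I A \<Longrightarrow> j \<in> I \<Longrightarrow> e b \<le> c * (\<Prod>m\<in>I - {j}. p m (b m))"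
    and rates: "\<And>B. B \<noteq> {} \<Longrightarrow> B \<subseteq> PiE I A \<Longrightarrow>
      (\<Sum>b\<in>B. rate (s\<^sup>2 / n * (\<Prod>j\<in>I. p j (b j))) (e b)) \<le>
        K * ((\<Sum>j\<in>I. \<Sum>l\<in>(\<lambda>b. b j) ` B. p j l * ln (exp 1 * n / p j l)) + real (card B) * \<Lambda>)"
  shows "(\<Sum>b\<in>{b \<in> PiE I A. s / n < box_scale I b}. e b * box_scale I b) \<le>
    exp 2 * 4 ^ card I * s + real (card I) * (2 * c / s * 4 ^ card I)
      + 2 * K * (12 * real (card I) * s + 2 ^ card I * \<Lambda>)"
proof -
  define H where "H = {b \<in> PiE I A. s / n < box_scale I b}"
  define T where "T = (\<lambda>b. exp 2 * (box_scale I b / (s / n)) * (s\<^sup>2 / n * (\<Prod>j\<in>I. p j (b j))))"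
  define S where "S = {b \<in> H. e b \<le> T b}"
  define U where "U = (\<lambda>j. {b \<in> H. (1/2)^b j * s < box_scale (I - {j}) b})"
  define G where "G = {b \<in> H. T b < e b \<and> (\<forall>j\<in>I. box_scale (I - {j}) b \<le> (1/2)^b j * s)}"
  have finH: "finite H" using finite_boxes by (simp add: H_def)
  have pos': "e b * box_scale I b \<ge> 0" if "b \<in> H" for b
    using that e0[of b] box_scale_pos[of I b] by (simp add: H_def)
  have "(\<Sum>b\<in>H. e b * box_scale I b) \<le>
      (\<Sum>b\<in>H. (if b \<in> S then e b * box_scale I b else 0)
        + (\<Sum>j\<in>I. if b \<in> U j then e b * box_scale I b else 0)
        + (if b \<in> G then e b * box_scale I b else 0))"
  proof (rule sum_mono)
    fix b assume b: "b \<in> H"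
    consider "b \<in> S" | "b \<in> G" | j where "j \<in> I" "b \<in> U j"
      using b by (force simp: S_def U_def G_def)
    then show "e b * box_scale I b \<le> (if b \<in> S then e b * box_scale I b else 0)
        + (\<Sum>j\<in>I. if b \<in> U j then e b * box_scale I b else 0)
        + (if b \<in> G then e b * box_scale I b else 0)"
    proof cases
      case 3
      then have "e b * box_scale I b \<le> (\<Sum>j\<in>I. if b \<in> U j then e b * box_scale I b else 0)"
        using pos'[OF b] finite_modes
          member_le_sum[of j I "\<lambda>j. if b \<in> U j then e b * box_scale I b else 0"] by auto
      then show ?thesis using pos'[OF b] by auto
    qed (use pos'[OF b] in \<open>auto intro!: sum_nonneg add_nonneg_nonneg\<close>)
  qed
  also have "\<dots> = (\<Sum>b\<in>S. e b * box_scale I b) + (\<Sum>j\<in>I. \<Sum>b\<in>U j. e b * box_scale I b)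
      + (\<Sum>b\<in>G. e b * box_scale I b)"
  proof -
    have "H \<inter> S = S" "H \<inter> G = G" "\<And>j. H \<inter> U j = U j"
      by (auto simp: S_def G_def U_def)
    then show ?thesis
      using finH
      by (simp add: sum.distrib sum.swap[of _ I H] flip: sum.inter_restrict)
  qed
  also have "(\<Sum>b\<in>S. e b * box_scale I b) \<le> exp 2 * 4 ^ card I * s"
    using assms(1,2) by (intro light_boxes_le[of s n]) (auto simp: S_def H_def T_def)
  also have "(\<Sum>j\<in>I. \<Sum>b\<in>U j. e b * box_scale I b) \<le> (\<Sum>j\<in>I. 2 * c / s * 4 ^ card I)"
    using assms(1,5) fib by (intro sum_mono unbalanced_boxes_le) (auto simp: U_def H_def)
  also have "(\<Sum>b\<in>G. e b * box_scale I b) \<le> 2 * K * (12 * real (card I) * s + 2 ^ card I * \<Lambda>)"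
    using assms(1-4) p_le
    by (intro dense_balanced_boxes_le[of s n] rates) (auto simp: G_def H_def T_def)
  finally show ?thesis by (simp add: H_def)
qed

end

section \<open>Dyadic levels of a vector\<close>

text \<open>Half-open intervals make the levels disjoint, put absolute value 1 into level 0 and
  leave zero coordinates in no level.\<close>

definition dyadic_level :: "(nat \<Rightarrow> real) \<Rightarrow> nat \<Rightarrow> nat \<Rightarrow> nat set" where
  "dyadic_level v n l = {i \<in> {1..n}. (1/2)^Suc l < \<bar>v i\<bar> \<and> \<bar>v i\<bar> \<le> (1/2)^l}"

lemma dyadic_level_subset: "dyadic_level v n l \<subseteq> {1..n}"
  by (auto simp: dyadic_level_def)

lemma dyadic_level_disjoint: "disjoint_family_on (dyadic_level v n) X"
proof -
  have "l' \<le> l" if "i \<in> dyadic_level v n l" "i \<in> dyadic_level v n l'" for i l l'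
  proof (rule ccontr)
    assume "\<not> l' \<le> l"
    then have "(1/2::real)^l' \<le> (1/2)^Suc l" by (intro power_decreasing) auto
    then show False using that by (auto simp: dyadic_level_def)
  qed
  then show ?thesis unfolding disjoint_family_on_def by (metis disjoint_iff le_antisym)
qed

lemma dyadic_exists:
  fixes z :: real
  assumes "z \<le> 1" and "(1/2)^L < z"
  shows "\<exists>l<L. (1/2)^Suc l < z \<and> z \<le> (1/2)^l"
  using assms(2)
proof (induction L)
  case (Suc L)
  then show ?case by (cases "(1/2)^L < z") (meson less_SucI, meson lessI not_less)
qed (use assms in simp)

text \<open>A coordinate in level \<open>l\<close> has square above \<open>(1/4)^Suc l\<close>,
  hence the factor 4. By disjointness each coordinate is counted at most once.\<close>

lemma dyadic_mass_le:
  assumes "finite X"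
  shows "(\<Sum>l\<in>X. real (card (dyadic_level v n l)) * (1/4)^l) \<le> 4 * (\<Sum>i=1..n. (v i)\<^sup>2)"
proof -
  have "(\<Sum>l\<in>X. real (card (dyadic_level v n l)) * (1/4)^l) \<le>
      (\<Sum>l\<in>X. \<Sum>i\<in>dyadic_level v n l. 4 * (v i)\<^sup>2)"
  proof (rule sum_mono)
    fix l
    have "(1/4)^l \<le> 4 * (v i)\<^sup>2" if "i \<in> dyadic_level v n l" for i
    proof -
      have "((1/2)^Suc l)\<^sup>2 \<le> \<bar>v i\<bar>\<^sup>2"
        using that by (intro power_mono) (auto simp: dyadic_level_def)
      then show ?thesis by (simp add: power2_eq_square flip: power_mult_distrib)
    qed
    then have "(\<Sum>i\<in>dyadic_level v n l. (1/4)^l) \<le> (\<Sum>i\<in>dyadic_level v n l. 4 * (v i)\<^sup>2)"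
      by (rule sum_mono)
    then show "real (card (dyadic_level v n l)) * (1/4)^l \<le>
        (\<Sum>i\<in>dyadic_level v n l. 4 * (v i)\<^sup>2)"
      by simp
  qed
  also have "\<dots> = (\<Sum>i\<in>(\<Union>l\<in>X. dyadic_level v n l). 4 * (v i)\<^sup>2)"
    using assms dyadic_level_disjoint[of v n X] finite_subset[OF dyadic_level_subset]
    by (subst sum.UNION_disjoint) (auto simp: disjoint_family_on_def)
  also have "\<dots> \<le> (\<Sum>i=1..n. 4 * (v i)\<^sup>2)"
    using dyadic_level_subset[of v n] by (intro sum_mono2) auto
  finally show ?thesis by (simp add: sum_distrib_left)
qed

section \<open>From tensor and vectors to box sums\<close>

lemma finite_multi_indices: "finite (multi_indices k n)"
  unfolding multi_indices_def by (rule finite_PiE) auto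

text \<open>Slice the box along mode \<open>j\<close>: each slice lies in a single fiber, and the
  slices are indexed by the choices of the other coordinates.\<close>

lemma entry_sum_box_le:
  assumes t: "\<And>i. i \<in> multi_indices k n \<Longrightarrow> t i \<ge> 0"
    and fib: "\<And>F. F \<in> fibers k n \<Longrightarrow> entry_sum t F \<le> c" and "c \<ge> 0"
    and D: "\<And>m. m \<in> {1..k} \<Longrightarrow> D m (b m) \<subseteq> {1..n}" and j: "j \<in> {1..k}"
  shows "entry_sum t (label_box k D b) \<le> c * (\<Prod>m\<in>{1..k} - {j}. real (card (D m (b m))))"
proof -
  define J where "J = {1..k} - {j}"
  define E where "E = (\<lambda>m. D m (b m))"
  have k: "{1..k} = insert j J" and "j \<notin> J" using j by (auto simp: J_def)
  have finE: "finite (E m)" if "m \<in> {1..k}" for m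
    using D[OF that] by (auto simp: E_def intro: finite_subset)
  have "entry_sum t (label_box k D b) = (\<Sum>i\<in>PiE (insert j J) E. t i)"
    by (simp only: entry_sum_def label_box_def k E_def)
  also have "\<dots> = (\<Sum>g\<in>PiE J E. \<Sum>l\<in>E j. t (g(j := l)))"
    by (rule sum_PiE_insert) fact
  also have "\<dots> \<le> (\<Sum>g\<in>PiE J E. c)"
  proof (rule sum_mono)
    fix g assume g: "g \<in> PiE J E"
    have mi: "g(j := l) \<in> multi_indices k n" if "l \<in> E j" for l
    proof -
      have "g(j := l) \<in> PiE (insert j J) E" using g that by (intro PiE_fun_upd) auto
      also have "\<dots> \<subseteq> multi_indices k n"
        using D unfolding multi_indices_def k by (intro PiE_mono) (simp add: E_def)
      finally show ?thesis .
    qed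
    show "(\<Sum>l\<in>E j. t (g(j := l))) \<le> c"
    proof (cases "E j = {}")
      case False
      then obtain l0 where l0: "l0 \<in> E j" by blast
      let ?F = "fiber k n j (g(j := l0))"
      have F: "?F \<in> fibers k n" using j mi[OF l0] by (auto simp: fibers_def)
      have finF: "finite ?F"
        by (rule finite_subset[OF _ finite_multi_indices]) (auto simp: fiber_def)
      have "(\<Sum>l\<in>E j. t (g(j := l))) = (\<Sum>i\<in>(\<lambda>l. g(j := l)) ` E j. t i)"
        by (subst sum.reindex) (auto intro!: inj_onI dest: fun_cong[of _ _ j])
      also have "\<dots> \<le> (\<Sum>i\<in>?F. t i)"
        using mi finF t by (intro sum_mono2) (auto simp: fiber_def split: if_splits)
      also have "\<dots> \<le> c" using fib[OF F] by (simp add: entry_sum_def)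
      finally show ?thesis .
    qed (use \<open>c \<ge> 0\<close> in simp)
  qed
  also have "\<dots> = c * (\<Prod>m\<in>J. real (card (E m)))"
    by (simp add: card_PiE J_def)
  finally show ?thesis by (simp add: J_def E_def)
qed

text \<open>One plus the floor exceeds the logarithm. Hence, if all coordinates are at most 1 in
  absolute value, those of a heavy multi-index lie in the available levels.\<close>

lemma num_labels_power:
  assumes "n \<ge> 1" and "1 \<le> d" "d < (real n)\<^sup>2"
  shows "(1/2) ^ num_labels n d < threshold n d"
proof -
  have s: "sqrt d < real n" "sqrt d \<ge> 1"
    using assms by (auto intro: real_less_lsqrt)
  have \<tau>: "threshold n d > 0" "1 / threshold n d > 1"
    using s assms by (auto simp: threshold_def intro!: divide_pos_pos)
  then have pos: "log 2 (1 / threshold n d) > 0" by (subst zero_less_log_cancel_iff) auto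
  have "log 2 (1 / threshold n d) < real (num_labels n d)"
    using pos by (simp add: num_labels_def) linarith
  then have "2 powr log 2 (1 / threshold n d) < 2 powr real (num_labels n d)"
    by simp
  then show ?thesis using \<tau> by (simp add: powr_realpow field_simps power_one_over)
qed

text \<open>By \<open>ln z \<le> z - 1\<close> at the square root of the number of labels, the left
  side is at most twice that root, so a bound on the number of labels linear in \<open>d\<close>
  suffices. The lower bound on \<open>d\<close> turns \<open>2 * ln (real n)\<close> into
  \<open>2 * d / c\<close>.\<close>

lemma ln_num_labels_le:
  assumes "n \<ge> 1" and "1 \<le> d" "d < (real n)\<^sup>2" and "c > 0" and "c * ln (real n) \<le> d"
  shows "ln (exp 1 * real (num_labels n d)) \<le> 2 * sqrt (1 + 2 / c) * sqrt d"
proof -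
  let ?L = "real (num_labels n d)"
  have L1: "?L \<ge> 1" by (simp add: num_labels_def)
  have s: "sqrt d < real n" "sqrt d \<ge> 1"
    using assms by (auto intro: real_less_lsqrt)
  have n_pos: "n > 0" using assms(1) by simp
  have n_le: "real n * 1 \<le> real n * sqrt d"
    using s by (intro mult_left_mono) auto
  have \<tau>: "1 < 1 / threshold n d" "1 / threshold n d \<le> real n"
    using s n_le by (auto simp: threshold_def field_simps)
  have "threshold n d > 0"
    using s assms by (auto simp: threshold_def intro!: divide_pos_pos)
  then have "log 2 (1 / threshold n d) > 0"
    using \<tau>(1) by (subst zero_less_log_cancel_iff) auto
  then have "?L \<le> 1 + log 2 (1 / threshold n d)"
    by (simp add: num_labels_def)
  also have "\<dots> \<le> 1 + log 2 (real n)"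
    using \<tau> \<open>threshold n d > 0\<close> n_pos by (subst add_le_cancel_left, subst log_le_cancel_iff) auto
  also have "\<dots> \<le> d + 2 * ln (real n)"
  proof -
    have "ln (real n) * 1 \<le> ln (real n) * (2 * ln 2)"
      using ln2_ge_two_thirds assms(1) by (intro mult_left_mono) auto
    then have "log 2 (real n) \<le> 2 * ln (real n)"
      by (simp add: log_def pos_divide_le_eq)
    then show ?thesis using assms(2) by simp
  qed
  also have "\<dots> \<le> (1 + 2 / c) * d"
    using assms(4,5) by (simp add: field_simps)
  finally have L: "sqrt ?L \<le> sqrt (1 + 2 / c) * sqrt d"
    by (simp flip: real_sqrt_mult)
  have "ln (exp 1 * ?L) = 1 + 2 * ln (sqrt ?L)"
    using L1 by (simp add: ln_mult ln_sqrt)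
  also have "\<dots> \<le> 2 * sqrt ?L" using L1 ln_le_minus_one[of "sqrt ?L"] by simp
  also note L
  finally show ?thesis by simp
qed

text \<open>Group heavy multi-indices by the levels of their coordinates. Each such box is itself
  heavy, as its scale dominates the product, and nonnegativity of \<open>t\<close> allows each group
  to be enlarged to its whole box.\<close>

lemma heavy_sum_le_boxes:
  assumes t: "\<And>i. i \<in> multi_indices k n \<Longrightarrow> t i \<ge> 0"
    and x: "\<And>j i. j \<in> {1..k} \<Longrightarrow> i \<in> {1..n} \<Longrightarrow> \<bar>x j i\<bar> \<le> 1"
    and L: "(1/2)^L < \<tau>"
    and A: "\<And>j l. j \<in> {1..k} \<Longrightarrow> l < L \<Longrightarrow> dyadic_level (x j) n l \<noteq> {} \<Longrightarrow> l \<in> A j"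
    and finA: "\<And>j. j \<in> {1..k} \<Longrightarrow> finite (A j)"
  shows "(\<Sum>i\<in>heavy k n \<tau> x. t i * (\<Prod>j\<in>{1..k}. \<bar>x j (i j)\<bar>)) \<le>
    (\<Sum>b\<in>{b \<in> PiE {1..k} A. \<tau> < box_scale {1..k} b}.
      entry_sum t (label_box k (\<lambda>j. dyadic_level (x j) n) b) * box_scale {1..k} b)"
proof -
  define D where "D = (\<lambda>j. dyadic_level (x j) n)"
  define H where "H = heavy k n \<tau> x"
  define B where "B = {b \<in> PiE {1..k} A. \<tau> < box_scale {1..k} b}"
  define lab where "lab = (\<lambda>i. \<lambda>j\<in>{1..k}. SOME l. l < L \<and> i j \<in> D j l)"
  have H: "i \<in> multi_indices k n" "\<tau> < (\<Prod>j\<in>{1..k}. \<bar>x j (i j)\<bar>)" if "i \<in> H" for i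
    using that by (auto simp: H_def heavy_def)
  have finH: "finite H"
    by (rule finite_subset[OF _ finite_multi_indices]) (auto simp: H_def heavy_def)
  have finB: "finite B"
    by (rule finite_subset[OF _ finite_PiE[OF finite_atLeastAtMost finA]]) (auto simp: B_def)
  have lab: "lab i j < L \<and> i j \<in> D j (lab i j)" if i: "i \<in> H" and j: "j \<in> {1..k}" for i j
  proof -
    have ij: "i m \<in> {1..n}" if "m \<in> {1..k}" for m
      using H(1)[OF i] that by (auto simp: multi_indices_def)
    have "(\<Prod>m\<in>{1..k}. \<bar>x m (i m)\<bar>) = \<bar>x j (i j)\<bar> * (\<Prod>m\<in>{1..k}-{j}. \<bar>x m (i m)\<bar>)"
      using j by (intro prod.remove) auto
    also have "\<dots> \<le> \<bar>x j (i j)\<bar> * 1"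
      using x ij by (intro mult_left_mono prod_le_1) auto
    finally have "(1/2)^L < \<bar>x j (i j)\<bar>" using H(2)[OF i] L by simp
    then have "\<exists>l. l < L \<and> i j \<in> D j l"
      using dyadic_exists[OF x[OF j ij[OF j]]] ij[OF j] by (auto simp: D_def dyadic_level_def)
    from someI_ex[OF this] show ?thesis using j by (simp add: lab_def)
  qed
  have prod_le: "(\<Prod>j\<in>{1..k}. \<bar>x j (i j)\<bar>) \<le> box_scale {1..k} (lab i)" if "i \<in> H" for i
    unfolding box_scale_def using lab[OF that]
    by (intro prod_mono) (auto simp: D_def dyadic_level_def)
  have labB: "lab ` H \<subseteq> B"
  proof
    fix b assume "b \<in> lab ` H"
    then obtain i where i: "i \<in> H" "b = lab i" by blast
    have "lab i j \<in> A j" if "j \<in> {1..k}" for j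
      using lab[OF i(1) that] that by (intro A) (auto simp: D_def)
    moreover have "lab i \<in> extensional {1..k}" by (simp add: lab_def)
    ultimately show "b \<in> B"
      using H(2)[OF i(1)] prod_le[OF i(1)] i(2) by (auto simp: B_def PiE_iff)
  qed
  have "(\<Sum>i\<in>H. t i * (\<Prod>j\<in>{1..k}. \<bar>x j (i j)\<bar>)) =
      (\<Sum>b\<in>B. \<Sum>i\<in>{i \<in> H. lab i = b}. t i * (\<Prod>j\<in>{1..k}. \<bar>x j (i j)\<bar>))"
    by (rule sum.group[symmetric]) (use finH finB labB in auto)
  also have "\<dots> \<le> (\<Sum>b\<in>B. entry_sum t (label_box k D b) * box_scale {1..k} b)"
  proof (rule sum_mono)
    fix b
    have sub: "label_box k D b \<subseteq> multi_indices k n"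
      by (auto simp: label_box_def multi_indices_def D_def dyadic_level_def PiE_iff)
    have "(\<Sum>i\<in>{i \<in> H. lab i = b}. t i * (\<Prod>j\<in>{1..k}. \<bar>x j (i j)\<bar>)) \<le>
        (\<Sum>i\<in>{i \<in> H. lab i = b}. t i * box_scale {1..k} b)"
      using prod_le t H(1) by (intro sum_mono mult_left_mono) auto
    also have "\<dots> \<le> (\<Sum>i\<in>label_box k D b. t i * box_scale {1..k} b)"
    proof (rule sum_mono2)
      show "finite (label_box k D b)"
        unfolding label_box_def D_def
        by (intro finite_PiE) (auto intro: finite_subset[OF dyadic_level_subset])
      show "{i \<in> H. lab i = b} \<subseteq> label_box k D b"
      proof
        fix i assume "i \<in> {i \<in> H. lab i = b}"
        then have "i \<in> extensional {1..k}" "\<And>j. j \<in> {1..k} \<Longrightarrow> i j \<in> D j (b j)"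
          using lab H(1) unfolding multi_indices_def PiE_iff by blast+
        then show "i \<in> label_box k D b" unfolding label_box_def PiE_iff by blast
      qed
      show "0 \<le> t i * box_scale {1..k} b" if "i \<in> label_box k D b - {i \<in> H. lab i = b}" for i
        using that sub t box_scale_pos[of "{1..k}" b] by (intro mult_nonneg_nonneg) auto
    qed
    finally show "(\<Sum>i\<in>{i \<in> H. lab i = b}. t i * (\<Prod>j\<in>{1..k}. \<bar>x j (i j)\<bar>)) \<le>
        entry_sum t (label_box k D b) * box_scale {1..k} b"
      by (simp add: entry_sum_def sum_distrib_right)
  qed
  finally show ?thesis by (simp add: H_def B_def D_def)
qed

section \<open>Assembly of the estimates\<close>

theorem proposition4p6:
  fixes k :: nat and c \<kappa> K :: real
  assumes "k \<ge> 2" and "c > 0" and "\<kappa> > 0" and "K > 0"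
  shows "\<exists>C::real. \<forall>(n::nat) (d::real) (t :: (nat \<Rightarrow> nat) \<Rightarrow> real).
    n \<ge> 1 \<longrightarrow> 1 \<le> d \<longrightarrow> d < (real n)\<^sup>2 \<longrightarrow> d \<ge> c * ln (real n) \<longrightarrow>
    (\<forall>i\<in>multi_indices k n. t i \<ge> 0) \<longrightarrow>
    (\<forall>F\<in>fibers k n. entry_sum t F \<le> \<kappa> * d) \<longrightarrow>
    (\<forall>A D B.
       (\<forall>j\<in>{1..k}. labeled_partial_partition n (num_labels n d) (A j) (D j)) \<longrightarrow>
       B \<noteq> {} \<longrightarrow> B \<subseteq> box_labels k A \<longrightarrow>
       (\<Sum>b\<in>B. box_rate k n d t D b)
         \<le> K * (label_entropy k n D B + real (card B) * ln (exp 1 * real (num_labels n d)))) \<longrightarrow>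
    (SUP x\<in>unit_tuples k n.
       ereal (\<Sum>i\<in>heavy k n (threshold n d) x. t i * (\<Prod>j\<in>{1..k}. \<bar>x j (i j)\<bar>)))
      \<le> ereal (C * sqrt d)"
proof (intro exI allI impI SUP_least)
  fix n :: nat and d :: real and t :: "(nat \<Rightarrow> nat) \<Rightarrow> real" and x :: "nat \<Rightarrow> nat \<Rightarrow> real"
  assume n: "n \<ge> 1" and d: "1 \<le> d" "d < (real n)\<^sup>2" and cd: "d \<ge> c * ln (real n)"
    and t: "\<forall>i\<in>multi_indices k n. t i \<ge> 0"
    and fib: "\<forall>F\<in>fibers k n. entry_sum t F \<le> \<kappa> * d"
    and rates: "\<forall>A D B.
       (\<forall>j\<in>{1..k}. labeled_partial_partition n (num_labels n d) (A j) (D j)) \<longrightarrow>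
       B \<noteq> {} \<longrightarrow> B \<subseteq> box_labels k A \<longrightarrow>
       (\<Sum>b\<in>B. box_rate k n d t D b)
         \<le> K * (label_entropy k n D B + real (card B) * ln (exp 1 * real (num_labels n d)))"
    and x: "x \<in> unit_tuples k n"
  define L where "L = num_labels n d"
  define \<Lambda> where "\<Lambda> = ln (exp 1 * real L)"
  define D where "D = (\<lambda>j. dyadic_level (x j) n)"
  \<comment> \<open>Empty levels stay unassigned: partial partitions require nonempty sets, and the
    locale requires positive sizes.\<close>
  define A where "A = (\<lambda>j. {l. l < L \<and> D j l \<noteq> {}})"
  define p where "p = (\<lambda>j l. real (card (D j l)))"
  define e where "e = (\<lambda>b. entry_sum t (label_box k D b))"
  have finD: "finite (D j l)" for j l
    unfolding D_def by (rule finite_subset[OF dyadic_level_subset]) simp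
  have norm: "(\<Sum>i=1..n. (x j i)\<^sup>2) = 1" if "j \<in> {1..k}" for j
    using x that by (simp add: unit_tuples_def L2_set_def)
  have x1: "\<bar>x j i\<bar> \<le> 1" if "j \<in> {1..k}" "i \<in> {1..n}" for j i
    using member_le_L2_set[of "{1..n}" i "\<lambda>i. \<bar>x j i\<bar>"] x that
    by (simp add: unit_tuples_def L2_set_def)
  interpret level_masses "{1..k}" A p
  proof
    show "(\<Sum>l\<in>A j. p j l * (1/4)^l) \<le> 4" if "j \<in> {1..k}" for j
      using dyadic_mass_le[of "A j" "x j" n] norm[OF that] by (simp add: p_def D_def A_def)
  qed (auto simp: A_def p_def card_gt_0_iff finD)
  have part: "labeled_partial_partition n L (A j) (D j)" for j
    using dyadic_level_subset dyadic_level_disjoint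
    by (auto simp: labeled_partial_partition_def A_def D_def)
  have "(\<Sum>i\<in>heavy k n (threshold n d) x. t i * (\<Prod>j\<in>{1..k}. \<bar>x j (i j)\<bar>)) \<le>
      (\<Sum>b\<in>{b \<in> PiE {1..k} A. threshold n d < box_scale {1..k} b}. e b * box_scale {1..k} b)"
    unfolding e_def D_def
    using t x1 num_labels_power[OF n d]
    by (intro heavy_sum_le_boxes[of k n t x L]) (auto simp: L_def A_def D_def)
  also have "\<dots> \<le> exp 2 * 4 ^ card {1..k} * sqrt d
      + real (card {1..k}) * (2 * (\<kappa> * d) / sqrt d * 4 ^ card {1..k})
      + 2 * K * (12 * real (card {1..k}) * sqrt d + 2 ^ card {1..k} * \<Lambda>)"
    unfolding threshold_def
  proof (rule heavy_boxes_le)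
    show "\<Lambda> \<ge> 0"
    proof -
      have "1 * 1 \<le> exp 1 * real L" by (intro mult_mono) (auto simp: L_def num_labels_def)
      then show ?thesis by (simp add: \<Lambda>_def)
    qed
    show "p j l \<le> real n" for j l
      using card_mono[OF _ dyadic_level_subset, of n "x j" l] by (simp add: p_def D_def)
    show "e b \<ge> 0" for b
    proof -
      have "label_box k D b \<subseteq> multi_indices k n"
        by (auto simp: label_box_def multi_indices_def D_def dyadic_level_def PiE_iff)
      then show ?thesis using t by (auto simp: e_def entry_sum_def intro!: sum_nonneg)
    qed
    show "e b \<le> \<kappa> * d * (\<Prod>m\<in>{1..k} - {j}. p m (b m))" if "j \<in> {1..k}" for b j
      unfolding e_def p_def
      using t fib that assms d dyadic_level_subset
      by (intro entry_sum_box_le[of k n]) (auto simp: D_def)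
    show "(\<Sum>b\<in>B. rate ((sqrt d)\<^sup>2 / real n * (\<Prod>j\<in>{1..k}. p j (b j))) (e b)) \<le>
        K * ((\<Sum>j\<in>{1..k}. \<Sum>l\<in>(\<lambda>b. b j) ` B. p j l * ln (exp 1 * real n / p j l))
          + real (card B) * \<Lambda>)"
      if "B \<noteq> {}" "B \<subseteq> PiE {1..k} A" for B
    proof -
      have "(\<Sum>b\<in>B. box_rate k n d t D b) \<le> K * (label_entropy k n D B + real (card B) * \<Lambda>)"
        using rates[rule_format, of A D B] part that by (simp add: box_labels_def L_def \<Lambda>_def)
      then show ?thesis
        using d
        by (simp add: box_rate_def label_entropy_def set_entropy_def e_def p_def label_box_def
            card_PiE)
    qed
  qed (use assms n d in auto)
  also have "\<dots> \<le> exp 2 * 4 ^ k * sqrt d + real k * (2 * \<kappa> * sqrt d * 4 ^ k)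
      + 2 * K * (12 * real k * sqrt d + 2 ^ k * (2 * sqrt (1 + 2 / c) * sqrt d))"
  proof -
    have "2 * (\<kappa> * d) / sqrt d = 2 * \<kappa> * sqrt d"
      using d by (simp add: field_simps)
    moreover have "\<Lambda> \<le> 2 * sqrt (1 + 2 / c) * sqrt d"
      unfolding \<Lambda>_def L_def by (rule ln_num_labels_le[OF n d assms(2) cd])
    ultimately show ?thesis using assms by (simp add: mult_left_mono)
  qed
  \<comment> \<open>The coefficient of \<open>sqrt d\<close> is the witness for \<open>C\<close>; it
    contains only \<open>k\<close>, \<open>c\<close>, \<open>\<kappa>\<close> and
    \<open>K\<close>.\<close>
  also have "\<dots> = (exp 2 * 4 ^ k + real k * (2 * \<kappa> * 4 ^ k)
      + 2 * K * (12 * real k + 2 ^ k * (2 * sqrt (1 + 2 / c)))) * sqrt d"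
    by (simp add: algebra_simps)
  finally show "ereal (\<Sum>i\<in>heavy k n (threshold n d) x. t i * (\<Prod>j\<in>{1..k}. \<bar>x j (i j)\<bar>)) \<le>
      ereal ((exp 2 * 4 ^ k + real k * (2 * \<kappa> * 4 ^ k)
        + 2 * K * (12 * real k + 2 ^ k * (2 * sqrt (1 + 2 / c)))) * sqrt d)"
    by simp
qed

end
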